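(* The complement of the positive range is $$\mathbb{Z}_{>0}\setminus\mathcal{H}^+=\bigcup_{n\ge3}\{H(n)+1,\ldots,H(n+1)-1\},$$ where an interval $\{H(n)+1,\ldots,H(n+1)-1\}$ is understood to be empty when $H(n+1)=H(n)+1$. The intervals in this union are pairwise disjoint.
   Context: $p(n)$ denotes the number of (unrestricted) partitions of the positive integer $n$, and $H(n):=p(n)-n$. The positive range is $\mathcal{H}^+:=\{H(n):n\ge 4\}$. $\{a,\ldots,b\}$ denotes the set of integers $m$ with $a\le m\le b$. *)

theory Defs
  imports Main "HOL-Library.Multiset" "HOL-Library.Disjoint_Sets"
begin

definition partitions :: "nat \<Rightarrow> nat multiset set" where
  "partitions n = {P. (\<forall>k\<in>#P. k > 0) \<and> sum_mset P = n}"

definition p :: "nat \<Rightarrow> nat" where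
  "p n = card (partitions n)"

definition H :: "nat \<Rightarrow> int" where
  "H n = int (p n) - int n"

definition positive_range :: "int set" where
  "positive_range = {H n | n. n \<ge> 4}"

end

(* Prepending a part 1 embeds the partitions of n into those of n + 1; the partitions missed are
   those without a part 1. For n >= 3 these include {n + 1} and {2, n - 1}, so
   p (n + 1) >= p n + 2 and H is strictly increasing from H 3 = 0 on. The gaps between
   consecutive values of such a sequence are disjoint and make up the complement of its range. *)

theory Submission
  imports Defs
begin

text \<open>Positive parts with sum \<open>n\<close> number at most \<open>n\<close>, and each is at
  most \<open>n\<close>, so every partition comes from one of finitely many lists.\<close>

lemma finite_partitions: "finite (partitions n)"
proof (rule finite_subset)
  show "partitions n \<subseteq> mset ` {xs. set xs \<subseteq> {..n} \<and> length xs \<le> n}"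
  proof
    fix P assume P: "P \<in> partitions n"
    obtain xs where xs: "P = mset xs" by (metis ex_mset)
    have pos: "\<forall>x\<in>set xs. 0 < x" and sum: "sum_list xs = n"
      using P xs by (auto simp: partitions_def sum_mset_sum_list)
    have "length xs \<le> sum_list xs" using pos by (induction xs) fastforce+
    moreover have "set xs \<subseteq> {..n}" using sum member_le_sum_list by auto
    ultimately show "P \<in> mset ` {xs. set xs \<subseteq> {..n} \<and> length xs \<le> n}"
      using xs sum by auto
  qed
  show "finite (mset ` {xs. set xs \<subseteq> {..n} \<and> length xs \<le> n})"
    by (intro finite_imageI finite_lists_length_le) auto
qed

lemma partitions_Suc:
  "partitions (Suc n) = add_mset 1 ` partitions n \<union> {P \<in> partitions (Suc n). 1 \<notin># P}"
proof (intro equalityI subsetI)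
  fix P assume P: "P \<in> partitions (Suc n)"
  show "P \<in> add_mset 1 ` partitions n \<union> {P \<in> partitions (Suc n). 1 \<notin># P}"
  proof (cases "1 \<in># P")
    case True
    then obtain Q where "P = add_mset 1 Q" by (metis insert_DiffM)
    with P show ?thesis by (auto simp: partitions_def)
  qed (use P in auto)
qed (auto simp: partitions_def)

lemma p_Suc: "p (Suc n) = p n + card {P \<in> partitions (Suc n). 1 \<notin># P}"
proof -
  have "card (partitions (Suc n)) =
      card (add_mset 1 ` partitions n) + card {P \<in> partitions (Suc n). 1 \<notin># P}"
    by (subst partitions_Suc, rule card_Un_disjoint) (auto simp: finite_partitions)
  also have "card (add_mset 1 ` partitions n) = card (partitions n)"
    by (rule card_image) (auto simp: inj_on_def)
  finally show ?thesis by (simp add: p_def)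
qed

lemma p_Suc_ge: "n \<ge> 3 \<Longrightarrow> p (Suc n) \<ge> p n + 2"
proof -
  assume n: "n \<ge> 3"
  \<comment> \<open>Since \<open>n\<close> is at least 3, \<open>n - 1\<close> is at least 2, so the
    second witness has no part 1 either.\<close>
  have "card {{#Suc n#}, {#2, n - 1#}} \<le> card {P \<in> partitions (Suc n). 1 \<notin># P}"
  proof (rule card_mono)
    show "finite {P \<in> partitions (Suc n). 1 \<notin># P}" by (simp add: finite_partitions)
  qed (use n in \<open>auto simp: partitions_def\<close>)
  then show ?thesis by (simp add: p_Suc)
qed

text \<open>All parts are at least 2, so two of them would already sum to at least 4.\<close>

lemma partitions_without_1:
  assumes "n \<in> {2, 3}"
  shows "{P \<in> partitions n. 1 \<notin># P} = {{#n#}}"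
proof (intro equalityI subsetI)
  fix P assume "P \<in> {P \<in> partitions n. 1 \<notin># P}"
  then have pos: "\<forall>k\<in>#P. 0 < k" and no1: "1 \<notin># P" and sum: "sum_mset P = n"
    by (simp_all add: partitions_def)
  have ge2: "k \<ge> 2" if "k \<in># P" for k
  proof -
    have "0 < k" "k \<noteq> 1" using pos no1 that by blast+
    then show ?thesis by simp
  qed
  obtain k Q where P: "P = add_mset k Q" using sum assms by (cases P) auto
  have "Q = {#}"
  proof (cases Q)
    case (add l R)
    then show ?thesis using ge2[of k] ge2[of l] P sum assms by auto
  qed
  then show "P \<in> {{#n#}}" using P sum by simp
qed (use assms in \<open>auto simp: partitions_def\<close>)

text \<open>Computed upward from \<open>p 0 = 1\<close> by \<open>p_Suc\<close>: the increments
  leading to 1, 2 and 3 are 0, 1 and 1.\<close>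

lemma p_3: "p 3 = 3"
proof -
  have "partitions 0 = {{#}}"
  proof (intro equalityI subsetI)
    fix P assume "P \<in> partitions 0"
    then show "P \<in> {{#}}" by (cases P) (auto simp: partitions_def)
  qed (simp add: partitions_def)
  then have "p 0 = 1" by (simp add: p_def)
  moreover have "card {P \<in> partitions (Suc 0). 1 \<notin># P} = 0"
  proof -
    have "1 \<in># P" if "P \<in> partitions (Suc 0)" for P
      using that by (cases P) (auto simp: partitions_def add_is_1)
    then have "{P \<in> partitions (Suc 0). 1 \<notin># P} = {}" by blast
    then show ?thesis by (simp only: card.empty)
  qed
  ultimately have "p 1 = 1" by (simp only: One_nat_def p_Suc)
  then have "p 2 = 2"
    using p_Suc[of 1] partitions_without_1[of 2] by (simp add: numeral_2_eq_2)
  then show ?thesis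
    using p_Suc[of 2] partitions_without_1[of 3] by (simp add: numeral_3_eq_3 numeral_2_eq_2)
qed

text \<open>At each step \<open>p\<close> gains at least 2 while the subtracted index gains only
  1.\<close>

lemma H_less: "3 \<le> i \<Longrightarrow> i < j \<Longrightarrow> H i < H j"
proof (induction j)
  case (Suc j)
  then have "H j < H (Suc j)" using p_Suc_ge[of j] by (simp add: H_def)
  with Suc show ?case by (cases "i = j") auto
qed simp

lemma H_le: "3 \<le> i \<Longrightarrow> i \<le> j \<Longrightarrow> H i \<le> H j"
  using H_less[of i j] by (cases "i = j") auto

lemma H_3: "H 3 = 0"
  by (simp add: H_def p_3)

text \<open>A strictly increasing integer sequence gains at least 1 per step. This crude bound shows
  that \<open>H\<close> eventually reaches any given integer.\<close>

lemma H_ge: "H (n + 3) \<ge> int n"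
proof (induction n)
  case (Suc n)
  then show ?case using H_less[of "n + 3" "Suc n + 3"] by simp
qed (simp add: H_3)

theorem theorem3p5:
  "{m :: int. m > 0} - positive_range = (\<Union>n\<in>{3..}. {H n + 1 .. H (n + 1) - 1}) \<and>
   disjoint_family_on (\<lambda>n. {H n + 1 .. H (n + 1) - 1}) {3..}"
proof (intro conjI equalityI subsetI)
  fix m assume m: "m \<in> {m :: int. m > 0} - positive_range"
  \<comment> \<open>The first index from 3 on where \<open>H\<close> reaches \<open>m\<close> is the
    right end of the gap sought.\<close>
  define n where "n = (LEAST n. m \<le> H (n + 3))"
  have "m \<le> H (nat m + 3)" using H_ge[of "nat m"] m by simp
  then have n: "m \<le> H (n + 3)" unfolding n_def by (rule LeastI)
  \<comment> \<open>Index 0 is impossible because \<open>H 3 = 0 < m\<close>, so a left end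
    exists.\<close>
  obtain k where k: "n = Suc k" using n m H_3 by (cases n) auto
  then have "H (k + 3) < m" using not_less_Least[of k "\<lambda>n. m \<le> H (n + 3)"] n_def by simp
  \<comment> \<open>As \<open>k + 4\<close> is at least 4, this value lies in the range that
    \<open>m\<close> avoids, which makes the upper bound strict.\<close>
  moreover have "H (k + 4) \<noteq> m" using m by (auto simp: positive_range_def)
  ultimately have "m \<in> {H (k + 3) + 1 .. H (k + 3 + 1) - 1}"
    using n k by (simp add: add.commute)
  then show "m \<in> (\<Union>n\<in>{3..}. {H n + 1 .. H (n + 1) - 1})"
    by (intro UN_I[of "k + 3"]) auto
next
  fix m assume "m \<in> (\<Union>n\<in>{3..}. {H n + 1 .. H (n + 1) - 1})"
  then obtain n where n: "n \<ge> 3" "H n < m" "m < H (n + 1)" by auto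
  \<comment> \<open>By monotonicity, \<open>H k\<close> is at most \<open>H n\<close> if
    \<open>k \<le> n\<close>, and at least \<open>H (n + 1)\<close> otherwise.\<close>
  have "m \<noteq> H k" if "k \<ge> 4" for k
    using n that H_le[of k n] H_le[of "n + 1" k] by (cases "k \<le> n") auto
  then have "m \<notin> positive_range" by (auto simp: positive_range_def)
  moreover have "m > 0" using n H_le[of 3 n] H_3 by simp
  ultimately show "m \<in> {m. m > 0} - positive_range" by simp
next
  have "{H i + 1 .. H (i + 1) - 1} \<inter> {H j + 1 .. H (j + 1) - 1} = {}" if "3 \<le> i" "i < j" for i j
    \<comment> \<open>The earlier gap ends below \<open>H (i + 1)\<close>, and the later one starts
      above \<open>H j\<close>.\<close>
    using H_le[of "i + 1" j] that by auto
  then show "disjoint_family_on (\<lambda>n. {H n + 1 .. H (n + 1) - 1}) {3..}"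
    unfolding disjoint_family_on_def by (metis (no_types, lifting) Int_commute atLeast_iff linorder_neqE_nat)
qed

end
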